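(* Let $X, Y, D, D^{\oplus}, E, E^{\oplus}$ be the matrices described in the context, and let $$\mathcal{A} := \{A\in\mathbb{C}^{m\times m} \;:\; A D = D^{\oplus} \text{ and } E^H A = (E^{\oplus})^H\}.$$ Suppose that the constraints defining $\mathcal{A}$ are compatible and possess no redundancies, i.e. (i) $E^H D^{\oplus} = (E^{\oplus})^H D$; (ii) $D$ and $E$ have full column rank. Let $D^{\perp}$ and $E^{\perp}$ be matrices whose columns form orthonormal bases of $\mathcal{N}(D^H)$ and $\mathcal{N}(E^H)$ respectively, and define $$C_0^* := D^{\oplus} D^{\dagger} + (E^{\dagger})^H (E^{\oplus})^H D^{\perp} (D^{\perp})^H, \qquad A^*_{\rm lsq} := (E^{\perp})^H (Y - C_0^* X)\left((D^{\perp})^H X\right)^{\dagger}.$$ Then the matrix $$C_0^* + E^{\perp} A^*_{\rm lsq} (D^{\perp})^H$$ is a minimizer of the problem $$\min_{A\in\mathcal{A}} \|A X - Y\|_F^2 .$$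
   Context: Notation: $M^H$ is the conjugate transpose, $M^{\dagger}$ the Moore-Penrose pseudo-inverse, $\mathcal{N}(M)$ the null space, $\|\cdot\|_F$ the Frobenius norm. Setting: $\upsilon^+ = \Gamma(\upsilon)$, $\upsilon\in\mathbb{R}^p$, is a discrete-time autonomous dynamical system with $\Gamma:\mathbb{R}^p\to\mathbb{R}^p$. Its Koopman operator $U$ acts on complex-valued functions $f$ on $\mathbb{R}^p$ (and entrywise on vectors of functions) by $U\circ f := f\circ\Gamma$. The dictionary $\psi=[\psi_i]_{i=1}^m$ is a column vector of $m$ complex-valued functions on $\mathbb{R}^p$. For sample points $\upsilon_1,\dots,\upsilon_n\in\mathbb{R}^p$, the data matrices are $X=[\psi(\upsilon_j)]_{j=1}^n$ and $Y=[\psi(\Gamma(\upsilon_j))]_{j=1}^n$ in $\mathbb{C}^{m\times n}$ (columns indexed by $j$). Constraint matrices: given states $\upsilon^{\rm geom}_1,\dots,\upsilon^{\rm geom}_g\in\mathbb{R}^p$, set $D=[\psi(\upsilon^{\rm geom}_i)]_{i=1}^g$ and $D^{\oplus}=[\psi(\Gamma(\upsilon^{\rm geom}_i))]_{i=1}^g$ in $\mathbb{C}^{m\times g}$. Given vectors $e_1,\dots,e_f\in\mathbb{C}^m$ for which there exist $e_j^{\oplus}\in\mathbb{C}^m$ with $U\circ(e_j^H\psi)=(e_j^{\oplus})^H\psi$ for every $j$, set $E=[e_j]_{j=1}^f$ and $E^{\oplus}=[e_j^{\oplus}]_{j=1}^f$ in $\mathbb{C}^{m\times f}$. *)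

theory Defs
  imports
    "HOL-Analysis.Finite_Cartesian_Product"
    "Jordan_Normal_Form.Matrix_Kernel"
    "Jordan_Normal_Form.Schur_Decomposition"
    "Jordan_Normal_Form.DL_Rank"
begin

unbundle no vec_syntax

text \<open>
  Matrices and column vectors are those of \<open>Jordan_Normal_Form\<close>, whose sizes are natural
  numbers; the complements \<open>D\<^sup>\<bottom>\<close>, \<open>E\<^sup>\<bottom>\<close> may therefore have no columns at all. The conjugate
  transpose is \<open>mat_adjoint\<close>, the Hermitian product \<open>\<Sum>\<^sub>i v\<^sub>i cnj(w\<^sub>i)\<close> is \<open>v \<bullet>c w\<close>.
  The state space is \<open>real ^ 'p\<close>, and a dictionary is a column vector of functions.
\<close>

type_synonym 'p observable = "real ^ 'p \<Rightarrow> complex"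

definition koopman ::
  "(real ^ 'p::finite \<Rightarrow> real ^ 'p) \<Rightarrow> 'p observable \<Rightarrow> 'p observable" where
  "koopman \<Gamma> f = f \<circ> \<Gamma>"

definition dict_at ::
  "('p::finite) observable Matrix.vec \<Rightarrow> real ^ 'p \<Rightarrow> complex Matrix.vec" where
  "dict_at \<psi> x = map_vec (\<lambda>f. f x) \<psi>"

text \<open>The observable \<open>e\<^sup>H \<psi>\<close>.\<close>

definition dict_comb ::
  "complex Matrix.vec \<Rightarrow> ('p::finite) observable Matrix.vec \<Rightarrow> 'p observable" where
  "dict_comb e \<psi> = (\<lambda>x. dict_at \<psi> x \<bullet>c e)"

definition data_matrix ::
  "('p::finite) observable Matrix.vec \<Rightarrow> (real ^ 'p) list \<Rightarrow> complex mat" where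
  "data_matrix \<psi> xs = mat_of_cols (dim_vec \<psi>) (map (dict_at \<psi>) xs)"

text \<open>The Moore-Penrose pseudo-inverse, as the unique solution of the four Penrose equations.\<close>

definition is_pinv :: "complex mat \<Rightarrow> complex mat \<Rightarrow> bool" where
  "is_pinv M P \<longleftrightarrow>
     P \<in> carrier_mat (dim_col M) (dim_row M) \<and>
     M * P * M = M \<and>
     P * M * P = P \<and>
     mat_adjoint (M * P) = M * P \<and>
     mat_adjoint (P * M) = P * M"

definition pinv :: "complex mat \<Rightarrow> complex mat" where
  "pinv M = (THE P. is_pinv M P)"

definition frobenius_norm :: "complex mat \<Rightarrow> real" where
  "frobenius_norm M = sqrt (\<Sum>i<dim_row M. \<Sum>j<dim_col M. (cmod (M $$ (i, j)))\<^sup>2)"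

definition full_column_rank :: "complex mat \<Rightarrow> bool" where
  "full_column_rank M \<longleftrightarrow> vec_space.rank (dim_row M) M = dim_col M"

text \<open>The columns of \<open>B\<close> form an orthonormal basis of the null space of \<open>M\<close>; orthonormality
  makes them pairwise distinct, so nothing is lost in passing to the set of columns.\<close>

definition orthonormal_kernel_basis :: "complex mat \<Rightarrow> complex mat \<Rightarrow> bool" where
  "orthonormal_kernel_basis M B \<longleftrightarrow>
     dim_row B = dim_col M \<and>
     (\<forall>i<dim_col B. \<forall>j<dim_col B. col B i \<bullet>c col B j = (if i = j then 1 else 0)) \<and>
     kernel.basis (dim_col M) M (set (cols B))"

definition constraint_set ::
  "complex mat \<Rightarrow> complex mat \<Rightarrow> complex mat \<Rightarrow> complex mat \<Rightarrow> complex mat set" where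
  "constraint_set D Dp E Ep =
     {A \<in> carrier_mat (dim_row D) (dim_row D).
        A * D = Dp \<and> mat_adjoint E * A = mat_adjoint Ep}"

end

theory Submission
  imports Defs
begin

text \<open>
  The full rank conditions give \<open>D\<^sup>\<dagger> D = 1\<close> and \<open>E\<^sup>\<dagger> E = 1\<close>. Since \<open>D D\<^sup>\<dagger>\<close> and
  \<open>D\<^sup>\<bottom> (D\<^sup>\<bottom>)\<^sup>H\<close> are complementary orthogonal projections, compatibility shows that \<open>C\<^sub>0\<close> is
  feasible. A difference \<open>B\<close> of feasible matrices satisfies \<open>B D = 0\<close> and \<open>E\<^sup>H B = 0\<close>, so the
  feasible set is \<open>{C\<^sub>0 + E\<^sup>\<bottom> Z (D\<^sup>\<bottom>)\<^sup>H}\<close> with \<open>Z\<close> unconstrained, and what remains is the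
  least squares problem for \<open>E\<^sup>\<bottom> Z W - (Y - C\<^sub>0 X)\<close> with \<open>W = (D\<^sup>\<bottom>)\<^sup>H X\<close>. It is solved by
  Pythagoras, as the residual at \<open>Z = (E\<^sup>\<bottom>)\<^sup>H (Y - C\<^sub>0 X) W\<^sup>\<dagger>\<close> is orthogonal to all
  \<open>E\<^sup>\<bottom> N W\<close>.
\<close>

section \<open>Matrix algebra with dimension equations as side conditions\<close>

text \<open>The sizes in \<open>carrier_mat\<close> premises do not occur in the equation itself,
  whereas equations between \<open>dim_row\<close> and \<open>dim_col\<close> are closed by simp. In
  this form the law and its companions below serve as conditional rewrite rules.\<close>

lemma assoc_mult_mat_dim:
  fixes A B C :: "'a::semiring_0 mat"
  assumes "dim_col A = dim_row B" "dim_col B = dim_row C"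
  shows "A * B * C = A * (B * C)"
  by (rule assoc_mult_mat[of A "dim_row A" "dim_col A" B "dim_col B" C "dim_col C"])
    (rule carrier_matI; use assms in simp)+

lemma mult_minus_distrib_mat_dim:
  fixes A B C :: "'a::ring mat"
  assumes "dim_col A = dim_row B" "dim_row B = dim_row C" "dim_col B = dim_col C"
  shows "A * (B - C) = A * B - A * C"
  by (rule mult_minus_distrib_mat[of _ "dim_row A" "dim_col A" _ "dim_col B"])
    (rule carrier_matI; use assms in simp)+

lemma minus_mult_distrib_mat_dim:
  fixes A B C :: "'a::ring mat"
  assumes "dim_col A = dim_row C" "dim_row A = dim_row B" "dim_col A = dim_col B"
  shows "(A - B) * C = A * C - B * C"
  by (rule minus_mult_distrib_mat[of _ "dim_row A" "dim_col A" _ _ "dim_col C"])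
    (rule carrier_matI; use assms in simp)+

lemma mult_add_distrib_mat_dim:
  fixes A B C :: "'a::ring mat"
  assumes "dim_col A = dim_row B" "dim_row B = dim_row C" "dim_col B = dim_col C"
  shows "A * (B + C) = A * B + A * C"
  by (rule mult_add_distrib_mat[of _ "dim_row A" "dim_col A" _ "dim_col B"])
    (rule carrier_matI; use assms in simp)+

lemma add_mult_distrib_mat_dim:
  fixes A B C :: "'a::ring mat"
  assumes "dim_col A = dim_row C" "dim_row A = dim_row B" "dim_col A = dim_col B"
  shows "(A + B) * C = A * C + B * C"
  by (rule add_mult_distrib_mat[of _ "dim_row A" "dim_col A" _ _ "dim_col C"])
    (rule carrier_matI; use assms in simp)+

lemmas mat_distrib_dim = mult_minus_distrib_mat_dim minus_mult_distrib_mat_dim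
  mult_add_distrib_mat_dim add_mult_distrib_mat_dim

lemma left_mult_one_mat_dim: "dim_row A = n \<Longrightarrow> 1\<^sub>m n * A = (A :: 'a::semiring_1 mat)"
  by (rule left_mult_one_mat[of _ _ "dim_col A"]) (rule carrier_matI; simp)+

lemma right_mult_one_mat_dim: "dim_col A = n \<Longrightarrow> A * 1\<^sub>m n = (A :: 'a::semiring_1 mat)"
  by (rule right_mult_one_mat[of _ "dim_row A"]) (rule carrier_matI; simp)+

lemma left_mult_zero_mat_dim:
  "dim_row A = n \<Longrightarrow> 0\<^sub>m k n * A = (0\<^sub>m k (dim_col A) :: 'a::semiring_0 mat)"
  by (rule left_mult_zero_mat) (rule carrier_matI; simp)+

lemma right_mult_zero_mat_dim:
  "dim_col A = n \<Longrightarrow> A * 0\<^sub>m n k = (0\<^sub>m (dim_row A) k :: 'a::semiring_0 mat)"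
  by (rule right_mult_zero_mat) (rule carrier_matI; simp)+

lemmas mat_unit_dim = left_mult_one_mat_dim right_mult_one_mat_dim
  left_mult_zero_mat_dim right_mult_zero_mat_dim

lemma minus_mat_eq_0_iff:
  fixes A B :: "'a::ab_group_add mat"
  assumes "dim_row A = n" "dim_row B = n" "dim_col A = k" "dim_col B = k"
  shows "A - B = 0\<^sub>m n k \<longleftrightarrow> A = B"
proof
  assume eq: "A - B = 0\<^sub>m n k"
  show "A = B"
  proof (rule eq_matI)
    fix i j assume ij: "i < dim_row B" "j < dim_col B"
    hence "(A - B) $$ (i, j) = 0" using assms by (simp add: eq)
    thus "A $$ (i, j) = B $$ (i, j)" using ij assms by simp
  qed (use assms in auto)
qed (use assms in auto)

section \<open>Conjugate transpose and cancellation\<close>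

lemma dim_mat_adjoint [simp]:
  "dim_row (mat_adjoint A) = dim_col A" "dim_col (mat_adjoint A) = dim_row A"
  by (auto simp: mat_adjoint_def)

lemma index_mat_adjoint [simp]:
  fixes A :: "complex mat"
  assumes "i < dim_col A" "j < dim_row A"
  shows "mat_adjoint A $$ (i, j) = cnj (A $$ (j, i))"
  using assms by (simp add: mat_adjoint_def mat_of_rows_index)

lemma mat_adjoint_mult:
  fixes A B :: "complex mat"
  assumes "dim_col A = dim_row B"
  shows "mat_adjoint (A * B) = mat_adjoint B * mat_adjoint A"
  using assms
  by (intro eq_matI) (auto simp: scalar_prod_def mult.commute)

lemma mat_adjoint_adjoint [simp]: "mat_adjoint (mat_adjoint A) = (A :: complex mat)"
  by (intro eq_matI) auto

lemma mat_adjoint_zero [simp]: "mat_adjoint (0\<^sub>m a b) = (0\<^sub>m b a :: complex mat)"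
  by (intro eq_matI) auto

lemma mat_adjoint_one [simp]: "mat_adjoint (1\<^sub>m a) = (1\<^sub>m a :: complex mat)"
  by (intro eq_matI) auto

text \<open>The j-th diagonal entry of A^H A is the sum of the squared moduli in column j, and a
  vanishing sum of nonnegative terms has only zero terms.\<close>

lemma mat_adjoint_mult_self_eq_0:
  fixes A :: "complex mat"
  assumes "mat_adjoint A * A = 0\<^sub>m (dim_col A) (dim_col A)"
  shows "A = 0\<^sub>m (dim_row A) (dim_col A)"
proof (rule eq_matI)
  fix i j assume "i < dim_row (0\<^sub>m (dim_row A) (dim_col A) :: complex mat)"
    "j < dim_col (0\<^sub>m (dim_row A) (dim_col A) :: complex mat)"
  hence i: "i < dim_row A" and j: "j < dim_col A" by auto
  have "0 = (mat_adjoint A * A) $$ (j, j)"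
    using assms j by simp
  also have "\<dots> = (\<Sum>k<dim_row A. complex_of_real ((cmod (A $$ (k, j)))\<^sup>2))"
    using j by (simp add: scalar_prod_def atLeast0LessThan complex_norm_square mult.commute
        del: of_real_power)
  also have "\<dots> = complex_of_real (\<Sum>k<dim_row A. (cmod (A $$ (k, j)))\<^sup>2)"
    by simp
  finally have "(\<Sum>k<dim_row A. (cmod (A $$ (k, j)))\<^sup>2) = 0"
    by (metis of_real_eq_0_iff)
  thus "A $$ (i, j) = 0\<^sub>m (dim_row A) (dim_col A) $$ (i, j)"
    using i j by (subst (asm) sum_nonneg_eq_0_iff) auto
qed auto

text \<open>For W = M (Z - Z') the assumption gives M^H W = 0, hence W^H W = (Z - Z')^H M^H W = 0
  and so W = 0.\<close>

lemma mat_adjoint_mult_left_cancel: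
  fixes M Z Z' :: "complex mat"
  assumes eq: "mat_adjoint M * (M * Z) = mat_adjoint M * (M * Z')"
    and dims: "dim_row Z = dim_col M" "dim_row Z' = dim_col M" "dim_col Z' = dim_col Z"
  shows "M * Z = M * Z'"
proof -
  let ?W = "M * Z - M * Z'"
  have zero: "mat_adjoint M * ?W = 0\<^sub>m (dim_col M) (dim_col Z)"
    using dims eq by (simp add: mult_minus_distrib_mat_dim minus_mat_eq_0_iff)
  have W: "?W = M * (Z - Z')"
    using dims by (simp add: mult_minus_distrib_mat_dim)
  have "mat_adjoint ?W * ?W = mat_adjoint (Z - Z') * (mat_adjoint M * ?W)"
    using dims by (simp only: W, subst mat_adjoint_mult) (simp_all add: assoc_mult_mat_dim)
  also have "\<dots> = 0\<^sub>m (dim_col ?W) (dim_col ?W)"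
    using dims by (simp add: zero mat_unit_dim)
  finally have "?W = 0\<^sub>m (dim_row ?W) (dim_col ?W)"
    by (rule mat_adjoint_mult_self_eq_0)
  thus ?thesis
    using dims by (simp add: minus_mat_eq_0_iff)
qed

text \<open>Adjoint form of the left cancellation, applied to M^H, Z^H and Z'^H.\<close>

lemma mat_adjoint_mult_right_cancel:
  fixes M Z Z' :: "complex mat"
  assumes eq: "Z * M * mat_adjoint M = Z' * M * mat_adjoint M"
    and dims: "dim_col Z = dim_row M" "dim_col Z' = dim_row M" "dim_row Z' = dim_row Z"
  shows "Z * M = Z' * M"
proof -
  have "mat_adjoint M * mat_adjoint Z = mat_adjoint M * mat_adjoint Z'"
    by (rule mat_adjoint_mult_left_cancel)
      (use dims arg_cong[OF eq, of mat_adjoint] in \<open>simp_all add: mat_adjoint_mult assoc_mult_mat_dim\<close>)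
  hence "mat_adjoint (Z * M) = mat_adjoint (Z' * M)"
    using dims by (simp add: mat_adjoint_mult)
  thus ?thesis by (metis mat_adjoint_adjoint)
qed

section \<open>Generalized inverses over a field\<close>

text \<open>Let R = M - M K M. Then M (1 - K M) = R = (1 - M K) M, so M G' M = M K M + R G R = M K M
  + R = M. This lifts a generalized inverse from a residual back to M.\<close>

lemma generalized_inverse_of_residual:
  fixes M K G :: "'a::ring_1 mat"
  assumes K: "dim_row K = dim_col M" "dim_col K = dim_row M"
    and G: "dim_row G = dim_col M" "dim_col G = dim_row M"
    and res: "(M - M * K * M) * G * (M - M * K * M) = M - M * K * M"
  defines "G' \<equiv> K + (1\<^sub>m (dim_col M) - K * M) * G * (1\<^sub>m (dim_row M) - M * K)"
  shows "M * G' * M = M"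
proof -
  have left: "M * (1\<^sub>m (dim_col M) - K * M) = M - M * K * M"
    using K by (simp add: mat_distrib_dim mat_unit_dim assoc_mult_mat_dim)
  have right: "(1\<^sub>m (dim_row M) - M * K) * M = M - M * K * M"
    using K by (simp add: mat_distrib_dim mat_unit_dim assoc_mult_mat_dim)
  have "M * G' * M = M * K * M +
      (M * (1\<^sub>m (dim_col M) - K * M)) * G * ((1\<^sub>m (dim_row M) - M * K) * M)"
    unfolding G'_def using K G
    by (simp add: mult_add_distrib_mat_dim add_mult_distrib_mat_dim assoc_mult_mat_dim)
  also have "\<dots> = M * K * M + (M - M * K * M)"
    by (simp only: left right res)
  also have "\<dots> = M"
    using K by (intro eq_matI) auto
  finally show ?thesis .
qed

text \<open>Subtracting the rank-one matrix through a nonzero entry clears the row of that entry and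
  creates no new nonzero row, so the number of nonzero rows decreases.\<close>

lemma generalized_inverse_exists:
  fixes M :: "'a::field mat"
  shows "\<exists>G \<in> carrier_mat (dim_col M) (dim_row M). M * G * M = M"
proof (induction "card {r. r < dim_row M \<and> (\<exists>c<dim_col M. M $$ (r, c) \<noteq> 0)}"
    arbitrary: M rule: less_induct)
  case less
  let ?rows = "\<lambda>M :: 'a mat. {r. r < dim_row M \<and> (\<exists>c<dim_col M. M $$ (r, c) \<noteq> 0)}"
  show ?case
  proof (cases "?rows M = {}")
    case True
    hence "M = 0\<^sub>m (dim_row M) (dim_col M)"
      by (intro eq_matI) auto
    moreover have "M * 0\<^sub>m (dim_col M) (dim_row M) * M = 0\<^sub>m (dim_row M) (dim_col M)"
      by (simp add: mat_unit_dim)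
    ultimately have "M * 0\<^sub>m (dim_col M) (dim_row M) * M = M" by metis
    thus ?thesis by (intro bexI[of _ "0\<^sub>m (dim_col M) (dim_row M)"]) auto
  next
    case False
    then obtain i j where i: "i < dim_row M" and j: "j < dim_col M" and nz: "M $$ (i, j) \<noteq> 0"
      by auto
    \<comment> \<open>The only nonzero entry of \<open>K\<close> is the inverse of the pivot, at the
      transposed position (j, i). Hence \<open>M * K * M\<close> is column j times row i of
      \<open>M\<close>, divided by the pivot.\<close>
    define K where "K = mat (dim_col M) (dim_row M)
      (\<lambda>(r, c). if r = j then if c = i then inverse (M $$ (i, j)) else 0 else 0)"
    have dimK: "dim_row K = dim_col M" "dim_col K = dim_row M"
      by (simp_all add: K_def)
    let ?R = "M - M * K * M"
    have dimR: "dim_row ?R = dim_row M" "dim_col ?R = dim_col M"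
      by simp_all
    have MK: "(M * K) $$ (r, c) = (if c = i then M $$ (r, j) / M $$ (i, j) else 0)"
      if "r < dim_row M" "c < dim_row M" for r c
    proof -
      have "(M * K) $$ (r, c) = (\<Sum>s = 0..<dim_col M. M $$ (r, s) * K $$ (s, c))"
        using that dimK by (simp add: scalar_prod_def)
      also have "\<dots> = (\<Sum>s = 0..<dim_col M.
          if s = j then if c = i then M $$ (r, j) / M $$ (i, j) else 0 else 0)"
        using that by (intro sum.cong) (auto simp: K_def divide_inverse)
      finally show ?thesis using j by simp
    qed
    have MKM: "(M * K * M) $$ (r, c) = M $$ (r, j) / M $$ (i, j) * M $$ (i, c)"
      if "r < dim_row M" "c < dim_col M" for r c
    proof -
      have "(M * K * M) $$ (r, c) = (\<Sum>s = 0..<dim_row M. (M * K) $$ (r, s) * M $$ (s, c))"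
        using that dimK by (simp add: scalar_prod_def)
      also have "\<dots> = (\<Sum>s = 0..<dim_row M.
          if s = i then M $$ (r, j) / M $$ (i, j) * M $$ (i, c) else 0)"
        using that by (intro sum.cong) (auto simp: MK simp del: index_mult_mat(1))
      finally show ?thesis using i by simp
    qed
    have R: "?R $$ (r, c) = M $$ (r, c) - M $$ (r, j) / M $$ (i, j) * M $$ (i, c)"
      if "r < dim_row M" "c < dim_col M" for r c
      using that by (simp add: MKM del: index_mult_mat(1))
    \<comment> \<open>If row r of \<open>M\<close> is zero, so is the factor
      \<open>M $$ (r, j)\<close>, and nothing is subtracted from that row.\<close>
    have "?rows ?R \<subseteq> ?rows M"
    proof
      fix r assume "r \<in> ?rows ?R"
      then obtain c where r: "r < dim_row M" and c: "c < dim_col M" and "?R $$ (r, c) \<noteq> 0"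
        by auto
      hence "M $$ (r, c) \<noteq> 0 \<or> M $$ (r, j) \<noteq> 0"
        by (auto simp: R simp del: index_mult_mat(1) index_minus_mat(1))
      thus "r \<in> ?rows M" using r c j by blast
    qed
    moreover have "i \<in> ?rows M" "i \<notin> ?rows ?R"
      using i j nz by (auto simp: R simp del: index_mult_mat(1) index_minus_mat(1))
    ultimately have "?rows ?R \<subset> ?rows M"
      by blast
    hence "card (?rows ?R) < card (?rows M)"
      by (intro psubset_card_mono) auto
    from less[OF this] obtain G where G: "G \<in> carrier_mat (dim_col ?R) (dim_row ?R)"
      and res: "?R * G * ?R = ?R" by blast
    let ?G = "K + (1\<^sub>m (dim_col M) - K * M) * G * (1\<^sub>m (dim_row M) - M * K)"
    have "M * ?G * M = M"
      using dimK G res by (intro generalized_inverse_of_residual) auto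
    moreover have "?G \<in> carrier_mat (dim_col M) (dim_row M)"
      using dimK G by (intro carrier_matI) simp_all
    ultimately show ?thesis by blast
  qed
qed

section \<open>The Moore-Penrose pseudo-inverse\<close>

text \<open>M P = (M Q)(M P), and since both factors are Hermitian the adjoint reverses them: M P =
  ((M P)(M Q))^H = (M Q)^H = M Q. In the same way P M = Q M, so P = P M P = Q M Q = Q.\<close>

lemma is_pinv_unique:
  assumes P: "is_pinv M P" and Q: "is_pinv M Q"
  shows "P = Q"
proof -
  have dims: "dim_row P = dim_col M" "dim_col P = dim_row M"
      "dim_row Q = dim_col M" "dim_col Q = dim_row M"
    using P Q by (auto simp: is_pinv_def)
  note P' = P[unfolded is_pinv_def] and Q' = Q[unfolded is_pinv_def]
  have "M * P = (M * Q) * (M * P)"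
  proof -
    have "(M * Q) * (M * P) = (M * Q * M) * P"
      using dims by (simp add: assoc_mult_mat_dim)
    thus ?thesis using Q' by simp
  qed
  also have "\<dots> = mat_adjoint ((M * P) * (M * Q))"
    using dims P' Q' by (subst mat_adjoint_mult) auto
  also have "(M * P) * (M * Q) = (M * P * M) * Q"
    using dims by (simp add: assoc_mult_mat_dim)
  also have "mat_adjoint \<dots> = M * Q"
    using P' Q' by simp
  finally have MP: "M * P = M * Q" .
  have "P * M = (P * M) * (Q * M)"
  proof -
    have "(P * M) * (Q * M) = P * (M * Q * M)"
      using dims by (simp add: assoc_mult_mat_dim)
    thus ?thesis using Q' by simp
  qed
  also have "\<dots> = mat_adjoint ((Q * M) * (P * M))"
    using dims P' Q' by (subst mat_adjoint_mult) auto
  also have "(Q * M) * (P * M) = Q * (M * P * M)"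
    using dims by (simp add: assoc_mult_mat_dim)
  also have "mat_adjoint \<dots> = Q * M"
    using P' Q' by simp
  finally have PM: "P * M = Q * M" .
  have "P = (P * M) * P" using P' by simp
  also have "\<dots> = Q * (M * P)"
    using dims by (simp add: PM assoc_mult_mat_dim)
  also have "\<dots> = Q * M * Q"
    using dims by (simp add: MP assoc_mult_mat_dim)
  finally show ?thesis using Q' by simp
qed

text \<open>Cancelling M^H in M^H M P M = M^H M gives M P M = M. The adjoint of \<open>left\<close>
  is (M P)^H M = M, so M P = (M P)^H (M P) is Hermitian; \<open>right\<close> gives P M = (P M)(P
  M)^H likewise.\<close>

lemma is_pinvI_normal:
  fixes M P :: "complex mat"
  assumes dims: "dim_row P = dim_col M" "dim_col P = dim_row M"
    and left: "mat_adjoint M * (M * P) = mat_adjoint M"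
    and right: "P * M * mat_adjoint M = mat_adjoint M"
    and PMP: "P * M * P = P"
  shows "is_pinv M P"
proof -
  have MPM: "M * P * M = M"
  proof -
    have "M * (P * M) = M * 1\<^sub>m (dim_col M)"
    proof (rule mat_adjoint_mult_left_cancel)
      have "mat_adjoint M * (M * (P * M)) = (mat_adjoint M * (M * P)) * M"
        using dims by (simp add: assoc_mult_mat_dim)
      thus "mat_adjoint M * (M * (P * M)) = mat_adjoint M * (M * 1\<^sub>m (dim_col M))"
        by (simp add: left mat_unit_dim)
    qed (use dims in auto)
    thus ?thesis using dims by (simp add: mat_unit_dim assoc_mult_mat_dim)
  qed
  have "mat_adjoint (M * P) * M = mat_adjoint (mat_adjoint M * (M * P))"
    using dims by (subst (2) mat_adjoint_mult) auto
  hence "mat_adjoint (M * P) * M = M" by (simp add: left)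
  hence "mat_adjoint (M * P) * (M * P) = M * P"
    using dims by (metis assoc_mult_mat_dim dim_mat_adjoint(2) index_mult_mat(2))
  hence herm1: "mat_adjoint (M * P) = M * P"
    by (metis mat_adjoint_adjoint mat_adjoint_mult dim_mat_adjoint(2))
  have "M * mat_adjoint (P * M) = mat_adjoint (P * M * mat_adjoint M)"
    using dims by (subst (2) mat_adjoint_mult) auto
  hence "M * mat_adjoint (P * M) = M" by (simp add: right)
  hence "P * M * mat_adjoint (P * M) = P * M"
    using dims by (metis assoc_mult_mat_dim dim_mat_adjoint(1) index_mult_mat(3))
  hence herm2: "mat_adjoint (P * M) = P * M"
    by (metis mat_adjoint_adjoint mat_adjoint_mult dim_mat_adjoint(1))
  show ?thesis
    unfolding is_pinv_def using dims MPM PMP herm1 herm2 by (auto intro: carrier_matI)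
qed

text \<open>Zlobec's formula \<open>M\<^sup>\<dagger> = M\<^sup>H G M\<^sup>H\<close>, where \<open>G\<close> is any generalized inverse of \<open>M\<^sup>H M M\<^sup>H\<close>.\<close>

lemma is_pinv_exists: "\<exists>P. is_pinv M P"
proof -
  let ?H = "mat_adjoint M"
  obtain G where G: "G \<in> carrier_mat (dim_row M) (dim_col M)"
    and eq: "(?H * M * ?H) * G * (?H * M * ?H) = ?H * M * ?H"
    using generalized_inverse_exists[of "?H * M * ?H"] by auto
  have dims: "dim_row G = dim_row M" "dim_col G = dim_col M" using G by auto
  define P where "P = ?H * G * ?H"
  have dimP: "dim_row P = dim_col M" "dim_col P = dim_row M" by (simp_all add: P_def)
  have left: "?H * (M * P) = ?H"
  proof -
    \<comment> \<open>Two cancellations strip the last two factors of \<open>eq\<close>: first the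
      trailing \<open>?H\<close> behind \<open>M\<close>, then the \<open>M\<close> behind
      \<open>?H\<close>, which is \<open>mat_adjoint ?H\<close>.\<close>
    have "(?H * M * ?H * G * ?H) * M = ?H * M"
      by (rule mat_adjoint_mult_right_cancel)
        (use eq dims in \<open>simp_all add: assoc_mult_mat_dim\<close>)
    hence "(?H * M * ?H * G) * ?H * mat_adjoint ?H = 1\<^sub>m (dim_col M) * ?H * mat_adjoint ?H"
      using dims by (simp add: mat_unit_dim)
    hence "(?H * M * ?H * G) * ?H = 1\<^sub>m (dim_col M) * ?H"
      by (rule mat_adjoint_mult_right_cancel) (use dims in simp_all)
    thus ?thesis
      using dims by (simp add: P_def mat_unit_dim assoc_mult_mat_dim)
  qed
  have right: "P * M * ?H = ?H"
  proof -
    \<comment> \<open>The mirror image: the first two factors of \<open>eq\<close> are stripped from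
      the left.\<close>
    have "M * (?H * (G * ?H * M * ?H)) = M * ?H"
      by (rule mat_adjoint_mult_left_cancel)
        (use eq dims in \<open>simp_all add: assoc_mult_mat_dim\<close>)
    hence "mat_adjoint ?H * (?H * (G * ?H * M * ?H)) = mat_adjoint ?H * (?H * 1\<^sub>m (dim_row M))"
      by (simp add: mat_unit_dim)
    hence "?H * (G * ?H * M * ?H) = ?H * 1\<^sub>m (dim_row M)"
      by (rule mat_adjoint_mult_left_cancel) (use dims in simp_all)
    thus ?thesis
      using dims by (simp add: P_def mat_unit_dim assoc_mult_mat_dim)
  qed
  have "P * M * P = ?H * G * (?H * (M * P))"
    using dims by (simp add: P_def assoc_mult_mat_dim)
  also have "\<dots> = P" unfolding left by (simp only: P_def)
  finally show ?thesis using is_pinvI_normal[OF dimP left right] by blast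
qed

lemma is_pinv_pinv: "is_pinv M (pinv M)"
  unfolding pinv_def using is_pinv_exists is_pinv_unique by (metis theI')

lemma dim_pinv [simp]: "dim_row (pinv M) = dim_col M" "dim_col (pinv M) = dim_row M"
  using is_pinv_pinv[of M] by (auto simp: is_pinv_def)

text \<open>Take the adjoint of M = M (\<open>pinv M\<close> M), whose second factor is
  Hermitian.\<close>

lemma pinv_mult_self_adjoint: "pinv M * M * mat_adjoint M = mat_adjoint M"
proof -
  have "mat_adjoint M = mat_adjoint (M * (pinv M * M))"
    using is_pinv_pinv[of M] by (simp add: is_pinv_def assoc_mult_mat_dim)
  also have "\<dots> = pinv M * M * mat_adjoint M"
    using is_pinv_pinv[of M] by (subst mat_adjoint_mult) (simp_all add: is_pinv_def)
  finally show ?thesis by simp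
qed

section \<open>Full column rank\<close>

text \<open>The rank is the size of a maximal independent subset of the set of columns, so full rank
  forces the columns to be pairwise distinct. They are then independent, while a nonzero kernel
  vector would be a linear dependence between them.\<close>

lemma full_column_rank_inj:
  assumes rank: "full_column_rank A" and v: "v \<in> carrier_vec (dim_col A)"
    and Av: "A *\<^sub>v v = 0\<^sub>v (dim_row A)"
  shows "v = 0\<^sub>v (dim_col A)"
proof (rule ccontr)
  assume nz: "v \<noteq> 0\<^sub>v (dim_col A)"
  interpret vec_space "TYPE(complex)" "dim_row A" .
  have A: "A \<in> carrier_mat (dim_row A) (dim_col A)" by simp
  have rk: "rank A = dim_col A" using rank by (simp add: full_column_rank_def)
  have sub: "set (cols A) \<subseteq> carrier_vec (dim_row A)" using cols_dim by blast
  obtain S where S: "maximal S (\<lambda>T. T \<subseteq> set (cols A) \<and> lin_indpt T)"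
    using maximal_exists[of "\<lambda>T. T \<subseteq> set (cols A) \<and> lin_indpt T" "card (set (cols A))" "{}"]
    by (meson List.finite_set card_mono empty_iff empty_subsetI finite_lin_indpt2 rev_finite_subset)
  hence "card S \<le> card (set (cols A))" by (simp add: card_mono maximal_def)
  hence "dim_col A \<le> card (set (cols A))"
    using rank_card_indpt[OF A S] rk by simp
  hence dist: "distinct (cols A)"
    by (metis card_distinct card_length cols_length le_antisym)
  from full_rank_lin_indpt[OF A rk dist] lin_depI[OF A v nz Av dist] show False by simp
qed

text \<open>By the first Penrose equation A annihilates every column of \<open>pinv A * A\<close> -
  1, and A is injective.\<close>

lemma pinv_mult_self_full_column_rank:
  assumes "full_column_rank A"
  shows "pinv A * A = 1\<^sub>m (dim_col A)"
proof (rule eq_matI)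
  let ?Z = "pinv A * A - 1\<^sub>m (dim_col A)"
  have AZ: "A * ?Z = 0\<^sub>m (dim_row A) (dim_col A)"
    using is_pinv_pinv[of A]
    by (simp add: is_pinv_def mat_distrib_dim mat_unit_dim assoc_mult_mat_dim minus_mat_eq_0_iff)
  fix i j assume "i < dim_row (1\<^sub>m (dim_col A) :: complex mat)" "j < dim_col (1\<^sub>m (dim_col A) :: complex mat)"
  hence ij: "i < dim_col A" "j < dim_col A" by auto
  have "A *\<^sub>v col ?Z j = col (A * ?Z) j"
    using ij by (intro eq_vecI) simp_all
  also have "\<dots> = 0\<^sub>v (dim_row A)" using ij by (simp add: AZ)
  finally have "col ?Z j = 0\<^sub>v (dim_col A)"
    using assms ij by (intro full_column_rank_inj) (auto intro: carrier_vecI)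
  hence "?Z $$ (i, j) = 0" using ij by (metis index_col index_zero_vec(1) dim_pinv(1)
      index_minus_mat(2,3) index_mult_mat(2,3) index_one_mat(2,3))
  thus "(pinv A * A) $$ (i, j) = 1\<^sub>m (dim_col A) $$ (i, j)"
    using ij by (simp del: index_mult_mat(1))
qed simp_all

section \<open>Orthonormal kernel bases and orthogonal projections\<close>

lemma orthonormal_kernel_basis_dim:
  "orthonormal_kernel_basis M K \<Longrightarrow> dim_row K = dim_col M"
  by (simp add: orthonormal_kernel_basis_def)

lemma orthonormal_kernel_basis_cols:
  assumes "orthonormal_kernel_basis M K"
  shows "set (cols K) \<subseteq> mat_kernel M" "kernel.span (dim_col M) M (set (cols K)) = mat_kernel M"
proof -
  interpret kernel "dim_row M" "dim_col M" M by unfold_locales simp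
  show "set (cols K) \<subseteq> mat_kernel M" "span (set (cols K)) = mat_kernel M"
    using assms by (auto simp: orthonormal_kernel_basis_def Ker.basis_def)
qed

lemma orthonormal_kernel_basis_mult_self:
  assumes "orthonormal_kernel_basis M K"
  shows "mat_adjoint K * K = 1\<^sub>m (dim_col K)"
proof (rule eq_matI)
  fix i j assume "i < dim_row (1\<^sub>m (dim_col K) :: complex mat)" "j < dim_col (1\<^sub>m (dim_col K) :: complex mat)"
  hence ij: "i < dim_col K" "j < dim_col K" by auto
  \<comment> \<open>The second argument of \<open>\<bullet>c\<close> is the conjugated one, so the
    two columns appear in swapped order.\<close>
  hence "(mat_adjoint K * K) $$ (i, j) = col K j \<bullet>c col K i"
    by (auto simp: scalar_prod_def intro!: sum.cong)
  thus "(mat_adjoint K * K) $$ (i, j) = 1\<^sub>m (dim_col K) $$ (i, j)"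
    using assms ij by (auto simp: orthonormal_kernel_basis_def)
qed simp_all

lemma orthonormal_kernel_basis_mult_eq_0:
  assumes "orthonormal_kernel_basis M K"
  shows "M * K = 0\<^sub>m (dim_row M) (dim_col K)"
proof (rule eq_matI)
  fix i j assume "i < dim_row (0\<^sub>m (dim_row M) (dim_col K) :: complex mat)"
    "j < dim_col (0\<^sub>m (dim_row M) (dim_col K) :: complex mat)"
  hence ij: "i < dim_row M" "j < dim_col K" by auto
  hence "col K j \<in> mat_kernel M"
    using orthonormal_kernel_basis_cols(1)[OF assms] by (auto simp: cols_def)
  hence "M *\<^sub>v col K j = 0\<^sub>v (dim_row M)" by (simp add: mat_kernel_def)
  hence "(M *\<^sub>v col K j) $ i = 0" using ij by simp
  thus "(M * K) $$ (i, j) = 0\<^sub>m (dim_row M) (dim_col K) $$ (i, j)"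
    using ij by simp
qed simp_all

text \<open>K K^H fixes every column of K because K^H K = 1, hence by linearity it fixes their span,
  which is the kernel.\<close>

lemma orthonormal_kernel_basis_proj_vec:
  assumes K: "orthonormal_kernel_basis M K" and v: "v \<in> mat_kernel M"
  shows "K * mat_adjoint K *\<^sub>v v = v"
proof -
  interpret kernel "dim_row M" "dim_col M" M by unfold_locales simp
  let ?n = "dim_col M"
  note dim = orthonormal_kernel_basis_dim[OF K]
  have KK: "K * mat_adjoint K \<in> carrier_mat ?n ?n" using dim by (intro carrier_matI) auto
  have sub: "set (cols K) \<subseteq> carrier_vec ?n" using cols_dim[of K] dim by simp
  have fix_col: "K * mat_adjoint K *\<^sub>v col K j = col K j" if "j < dim_col K" for j
  proof -
    have "K * mat_adjoint K *\<^sub>v col K j = col (K * mat_adjoint K * K) j"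
      using that by (intro eq_vecI) simp_all
    also have "K * mat_adjoint K * K = K"
      by (simp add: assoc_mult_mat_dim orthonormal_kernel_basis_mult_self[OF K] mat_unit_dim)
    finally show ?thesis .
  qed
  \<comment> \<open>For kernel vectors the span inside the kernel agrees with the span in the
    ambient space, where linear combinations are computed.\<close>
  have "v \<in> NC.span (set (cols K))"
    using v orthonormal_kernel_basis_cols[OF K] span_same by auto
  then obtain a where v_eq: "v = NC.lincomb a (set (cols K))"
    using NC.finite_in_span[OF _ sub] by auto
  have "K * mat_adjoint K *\<^sub>v NC.lincomb a S = NC.lincomb a S" if "finite S" "S \<subseteq> set (cols K)" for S
    using that
  proof (induction S rule: finite_induct)
    case empty
    have "K * mat_adjoint K *\<^sub>v 0\<^sub>v ?n = 0\<^sub>v ?n"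
      using KK by (intro eq_vecI) (auto simp: scalar_prod_def)
    thus ?case by (simp add: NC.lincomb_def)
  next
    case (insert x S)
    obtain j where j: "j < dim_col K" "x = col K j"
      using insert.prems by (auto simp: cols_def)
    have x: "x \<in> carrier_vec ?n" and S: "S \<subseteq> carrier_vec ?n" using insert.prems sub by auto
    have lc: "NC.lincomb a S \<in> carrier_vec ?n" using S NC.lincomb_closed by auto
    have "NC.lincomb a (insert x S) = a x \<cdot>\<^sub>v x + NC.lincomb a S"
      using NC.lincomb_insert2[OF insert.hyps(1) S _ insert.hyps(2) x] by simp
    thus ?case
      using insert x lc KK fix_col[OF j(1)] j(2)
      by (simp add: mult_add_distrib_mat_vec[OF KK] mult_mat_vec[OF KK])
  qed
  from this[of "set (cols K)"] show ?thesis using v_eq by simp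
qed

lemma orthonormal_kernel_basis_proj:
  assumes K: "orthonormal_kernel_basis M K" and B: "dim_row B = dim_col M"
    and zero: "M * B = 0\<^sub>m (dim_row M) (dim_col B)"
  shows "K * mat_adjoint K * B = B"
proof (rule eq_matI)
  fix i j assume ij: "i < dim_row B" "j < dim_col B"
  have "M *\<^sub>v col B j = col (M * B) j"
    using ij by (intro eq_vecI) simp_all
  hence "col B j \<in> mat_kernel M"
    using ij B by (auto simp: mat_kernel_def zero intro: carrier_vecI)
  hence "(K * mat_adjoint K *\<^sub>v col B j) $ i = col B j $ i"
    using orthonormal_kernel_basis_proj_vec[OF K] by simp
  thus "(K * mat_adjoint K * B) $$ (i, j) = B $$ (i, j)"
    using ij B orthonormal_kernel_basis_dim[OF K] by simp
qed (use B orthonormal_kernel_basis_dim[OF K] in simp_all)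

text \<open>Let P = K K^H and Q = 1 - D \<open>pinv D\<close>. From D^H Q = 0 the columns of Q lie
  in the kernel of D^H, so P Q = Q; from K^H D = 0 also P Q = P. Hence P = Q.\<close>

lemma range_kernel_decomposition:
  assumes rank: "full_column_rank D" and K: "orthonormal_kernel_basis (mat_adjoint D) K"
  shows "D * pinv D + K * mat_adjoint K = 1\<^sub>m (dim_row D)"
proof -
  note dim = orthonormal_kernel_basis_dim[OF K, simplified]
  let ?P = "K * mat_adjoint K"
  have "mat_adjoint D * (D * pinv D) = mat_adjoint (D * pinv D * D)"
    using is_pinv_pinv[of D] by (subst mat_adjoint_mult) (simp_all add: is_pinv_def)
  hence DDD: "mat_adjoint D * (D * pinv D) = mat_adjoint D"
    using is_pinv_pinv[of D] by (simp add: is_pinv_def)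
  have "?P * (1\<^sub>m (dim_row D) - D * pinv D) = 1\<^sub>m (dim_row D) - D * pinv D"
    by (rule orthonormal_kernel_basis_proj[OF K])
      (simp_all add: mat_distrib_dim mat_unit_dim DDD minus_mat_eq_0_iff)
  moreover have "mat_adjoint K * D = 0\<^sub>m (dim_col K) (dim_col D)"
    using arg_cong[OF orthonormal_kernel_basis_mult_eq_0[OF K], of mat_adjoint] dim
    by (simp add: mat_adjoint_mult)
  hence "mat_adjoint K * (D * pinv D) = 0\<^sub>m (dim_col K) (dim_row D)"
    using dim by (simp add: assoc_mult_mat_dim[symmetric] mat_unit_dim)
  hence "?P * (1\<^sub>m (dim_row D) - D * pinv D) = ?P"
    using dim by (simp add: mat_distrib_dim mat_unit_dim assoc_mult_mat_dim)
      (intro eq_matI; simp)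
  ultimately have "?P = 1\<^sub>m (dim_row D) - D * pinv D" by simp
  thus ?thesis by (simp only:) (intro eq_matI; simp)
qed

section \<open>Frobenius inner product and unconstrained least squares\<close>

definition frob_inner :: "complex mat \<Rightarrow> complex mat \<Rightarrow> complex" where
  "frob_inner A B = (\<Sum>i<dim_row A. \<Sum>j<dim_col A. A $$ (i, j) * cnj (B $$ (i, j)))"

text \<open>Both sides are the sum of A_ik B_kj cnj(C_ij) over i, j, k; the exchanges move the sum
  over i innermost, where it forms an entry of A^H C.\<close>

lemma frob_inner_mult_left:
  assumes "dim_col A = dim_row B" "dim_row C = dim_row A" "dim_col C = dim_col B"
  shows "frob_inner (A * B) C = frob_inner B (mat_adjoint A * C)"
proof -
  have "frob_inner (A * B) C = (\<Sum>i<dim_row A. \<Sum>j<dim_col B. \<Sum>k<dim_row B.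
      A $$ (i, k) * B $$ (k, j) * cnj (C $$ (i, j)))"
    using assms by (simp add: frob_inner_def scalar_prod_def sum_distrib_right atLeast0LessThan)
  also have "\<dots> = (\<Sum>i<dim_row A. \<Sum>k<dim_row B. \<Sum>j<dim_col B.
      A $$ (i, k) * B $$ (k, j) * cnj (C $$ (i, j)))"
    by (intro sum.cong refl sum.swap)
  also have "\<dots> = (\<Sum>k<dim_row B. \<Sum>i<dim_row A. \<Sum>j<dim_col B.
      A $$ (i, k) * B $$ (k, j) * cnj (C $$ (i, j)))"
    by (rule sum.swap)
  also have "\<dots> = (\<Sum>k<dim_row B. \<Sum>j<dim_col B. \<Sum>i<dim_row A.
      A $$ (i, k) * B $$ (k, j) * cnj (C $$ (i, j)))"
    by (intro sum.cong refl sum.swap)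
  also have "\<dots> = frob_inner B (mat_adjoint A * C)"
    using assms
    by (simp add: frob_inner_def scalar_prod_def sum_distrib_left atLeast0LessThan mult_ac)
  finally show ?thesis .
qed

lemma frob_inner_mult_right:
  assumes "dim_col A = dim_row B" "dim_row C = dim_row A" "dim_col C = dim_col B"
  shows "frob_inner (A * B) C = frob_inner A (C * mat_adjoint B)"
proof -
  have "frob_inner (A * B) C = (\<Sum>i<dim_row A. \<Sum>j<dim_col B. \<Sum>k<dim_row B.
      A $$ (i, k) * B $$ (k, j) * cnj (C $$ (i, j)))"
    using assms by (simp add: frob_inner_def scalar_prod_def sum_distrib_right atLeast0LessThan)
  also have "\<dots> = (\<Sum>i<dim_row A. \<Sum>k<dim_row B. \<Sum>j<dim_col B.
      A $$ (i, k) * B $$ (k, j) * cnj (C $$ (i, j)))"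
    by (intro sum.cong refl sum.swap)
  also have "\<dots> = frob_inner A (C * mat_adjoint B)"
    using assms
    by (simp add: frob_inner_def scalar_prod_def sum_distrib_left atLeast0LessThan mult_ac)
  finally show ?thesis .
qed

text \<open>Pythagoras: the cross term is twice the real part of the inner product and vanishes; the
  square of the norm of A is dropped.\<close>

lemma frobenius_norm_le_add_orthogonal:
  assumes dims: "dim_row A = dim_row B" "dim_col A = dim_col B"
    and orth: "frob_inner A B = 0"
  shows "(frobenius_norm B)\<^sup>2 \<le> (frobenius_norm (A + B))\<^sup>2"
proof -
  have norm_sq: "(frobenius_norm C)\<^sup>2 = (\<Sum>i<dim_row C. \<Sum>j<dim_col C. (cmod (C $$ (i, j)))\<^sup>2)" for C
    by (simp add: frobenius_norm_def sum_nonneg)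
  have cmod_add: "(cmod (x + y))\<^sup>2 = (cmod x)\<^sup>2 + (cmod y)\<^sup>2 + 2 * Re (x * cnj y)" for x y
    unfolding cmod_power2 by (simp add: power2_eq_square algebra_simps)
  have "(frobenius_norm (A + B))\<^sup>2 =
      (frobenius_norm A)\<^sup>2 + (frobenius_norm B)\<^sup>2 + 2 * Re (frob_inner A B)"
    using dims by (simp add: norm_sq cmod_add sum.distrib frob_inner_def sum_distrib_left)
  thus ?thesis using orth by simp
qed

text \<open>The normal equations hold because \<open>W\<^sup>\<dagger> W W\<^sup>H = W\<^sup>H\<close>.\<close>

lemma pinv_least_squares:
  fixes L W R :: "complex mat"
  assumes L: "mat_adjoint L * L = 1\<^sub>m (dim_col L)"
    and R: "dim_row R = dim_row L" "dim_col R = dim_col W"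
    and N: "dim_row N = dim_col L" "dim_col N = dim_row W"
  shows "(frobenius_norm (L * (mat_adjoint L * R * pinv W) * W - R))\<^sup>2
      \<le> (frobenius_norm (L * N * W - R))\<^sup>2"
proof -
  let ?Z = "mat_adjoint L * R * pinv W"
  let ?Q = "L * ?Z * W - R"
  have LLX: "mat_adjoint L * (L * X) = X" if "dim_row X = dim_col L" for X
    using that by (simp add: assoc_mult_mat_dim[symmetric] L mat_unit_dim)
  \<comment> \<open>Since L^H L = 1, the left side is L^H R (\<open>pinv W\<close> W W^H -
    W^H).\<close>
  have "mat_adjoint L * ?Q * mat_adjoint W = 0\<^sub>m (dim_col L) (dim_row W)"
    using R pinv_mult_self_adjoint[of W]
    by (simp add: mat_distrib_dim assoc_mult_mat_dim LLX minus_mat_eq_0_iff)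
  hence "frob_inner (N - ?Z) (mat_adjoint L * ?Q * mat_adjoint W) = 0"
    using N by (simp add: frob_inner_def)
  \<comment> \<open>Moving \<open>W\<close> and then \<open>L\<close> to the other argument exposes
    the matrix just shown to be zero.\<close>
  moreover have "frob_inner (L * (N - ?Z) * W) ?Q = frob_inner (L * (N - ?Z)) (?Q * mat_adjoint W)"
    using N R by (intro frob_inner_mult_right) simp_all
  moreover have "\<dots> = frob_inner (N - ?Z) (mat_adjoint L * (?Q * mat_adjoint W))"
    using N R by (intro frob_inner_mult_left) simp_all
  moreover have "mat_adjoint L * (?Q * mat_adjoint W) = mat_adjoint L * ?Q * mat_adjoint W"
    using N R by (intro assoc_mult_mat_dim[symmetric]) simp_all
  ultimately have "frob_inner (L * (N - ?Z) * W) ?Q = 0"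
    by (simp only:)
  hence "(frobenius_norm ?Q)\<^sup>2 \<le> (frobenius_norm (L * (N - ?Z) * W + ?Q))\<^sup>2"
    using N R by (intro frobenius_norm_le_add_orthogonal) simp_all
  also have "L * (N - ?Z) * W + ?Q = L * N * W - R"
  proof -
    have "L * (N - ?Z) * W = L * N * W - L * ?Z * W"
      using N R by (simp add: mat_distrib_dim assoc_mult_mat_dim)
    thus ?thesis using N R by (simp only:) (intro eq_matI; simp)
  qed
  finally show ?thesis .
qed

section \<open>The feasible set and the constrained minimizer\<close>

text \<open>The added term is invisible to both constraints: K^H D = 0, as the adjoint of D^H K = 0,
  and E^H L = 0.\<close>

lemma constraint_set_shift:
  assumes C: "C \<in> constraint_set D Dp E Ep" and row: "dim_row D = dim_row E"
    and K: "orthonormal_kernel_basis (mat_adjoint D) K"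
    and L: "orthonormal_kernel_basis (mat_adjoint E) L"
    and Z: "dim_row Z = dim_col L" "dim_col Z = dim_col K"
  shows "C + L * Z * mat_adjoint K \<in> constraint_set D Dp E Ep"
proof -
  note dim = orthonormal_kernel_basis_dim[OF K, simplified] orthonormal_kernel_basis_dim[OF L, simplified]
  have CD: "dim_row C = dim_row D" "dim_col C = dim_row D" "C * D = Dp"
    "mat_adjoint E * C = mat_adjoint Ep"
    using C by (auto simp: constraint_set_def)
  have KD: "mat_adjoint K * D = 0\<^sub>m (dim_col K) (dim_col D)"
    using arg_cong[OF orthonormal_kernel_basis_mult_eq_0[OF K], of mat_adjoint] dim
    by (simp add: mat_adjoint_mult)
  have EL: "mat_adjoint E * (L * X) = 0\<^sub>m (dim_col E) (dim_col X)" if "dim_row X = dim_col L" for X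
    using that dim orthonormal_kernel_basis_mult_eq_0[OF L]
    by (simp add: assoc_mult_mat_dim[symmetric] mat_unit_dim)
  \<comment> \<open>The sizes of \<open>Dp\<close> and \<open>Ep\<close> are read off from the
    constraint equations satisfied by \<open>C\<close>.\<close>
  have "dim_row Dp = dim_row D" "dim_col Dp = dim_col D"
    "dim_row Ep = dim_row D" "dim_col Ep = dim_col E"
    using CD(1,2) arg_cong[OF CD(3), of dim_row] arg_cong[OF CD(3), of dim_col]
      arg_cong[OF CD(4), of dim_row] arg_cong[OF CD(4), of dim_col] by auto
  hence "(C + L * Z * mat_adjoint K) * D = Dp"
    "mat_adjoint E * (C + L * Z * mat_adjoint K) = mat_adjoint Ep"
    using dim CD row Z
    by (auto simp: mat_distrib_dim mat_unit_dim assoc_mult_mat_dim KD EL)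
  thus ?thesis
    using CD dim row Z by (auto simp: constraint_set_def intro: carrier_matI)
qed

text \<open>For B = A - C, E^H B = 0 gives L L^H B = B. From B D = 0 the columns of B^H lie in the
  kernel of D^H, so K K^H B^H = B^H, and the adjoint is B K K^H = B.\<close>

lemma constraint_set_difference:
  assumes A: "A \<in> constraint_set D Dp E Ep" and C: "C \<in> constraint_set D Dp E Ep"
    and row: "dim_row D = dim_row E"
    and K: "orthonormal_kernel_basis (mat_adjoint D) K"
    and L: "orthonormal_kernel_basis (mat_adjoint E) L"
  shows "L * (mat_adjoint L * (A - C) * K) * mat_adjoint K = A - C"
proof -
  note dim = orthonormal_kernel_basis_dim[OF K, simplified] orthonormal_kernel_basis_dim[OF L, simplified]
  let ?B = "A - C"
  have dims: "dim_row A = dim_row D" "dim_col A = dim_row D"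
     "dim_row C = dim_row D" "dim_col C = dim_row D"
     and eqs: "A * D = C * D" "mat_adjoint E * A = mat_adjoint E * C"
    using A C by (auto simp: constraint_set_def)
  have "?B * D = 0\<^sub>m (dim_row D) (dim_col D)"
    using dims eqs by (simp add: mat_distrib_dim minus_mat_eq_0_iff)
  from arg_cong[OF this, of mat_adjoint]
  have "K * mat_adjoint K * mat_adjoint ?B = mat_adjoint ?B"
    using dims by (intro orthonormal_kernel_basis_proj[OF K]) (simp_all add: mat_adjoint_mult)
  from arg_cong[OF this, of mat_adjoint]
  have BK: "?B * (K * mat_adjoint K) = ?B"
    using dims dim by (simp add: mat_adjoint_mult)
  have LB: "L * mat_adjoint L * ?B = ?B"
    using dims row eqs
    by (intro orthonormal_kernel_basis_proj[OF L])
      (simp_all add: mat_distrib_dim minus_mat_eq_0_iff)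
  have "L * (mat_adjoint L * ?B * K) * mat_adjoint K = (L * mat_adjoint L * ?B) * (K * mat_adjoint K)"
    using dims dim row by (simp add: assoc_mult_mat_dim)
  thus ?thesis by (simp only: LB BK)
qed

text \<open>Multiplying by D leaves Dp, as \<open>pinv D\<close> D = 1 and K^H D = 0. Multiplying by
  E^H, compatibility and E^H (\<open>pinv E\<close>)^H = 1 give Ep^H (D \<open>pinv D\<close> + K
  K^H), and the two projections sum to 1.\<close>

lemma particular_solution_in_constraint_set:
  assumes dims: "dim_row E = dim_row D" "dim_row Dp = dim_row D" "dim_col Dp = dim_col D"
      "dim_row Ep = dim_row D" "dim_col Ep = dim_col E"
    and compatible: "mat_adjoint E * Dp = mat_adjoint Ep * D"
    and D: "full_column_rank D" and E: "full_column_rank E"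
    and K: "orthonormal_kernel_basis (mat_adjoint D) K"
  shows "Dp * pinv D + mat_adjoint (pinv E) * mat_adjoint Ep * K * mat_adjoint K
    \<in> constraint_set D Dp E Ep" (is "?C \<in> _")
proof -
  note dim = orthonormal_kernel_basis_dim[OF K, simplified]
  have KD: "mat_adjoint K * D = 0\<^sub>m (dim_col K) (dim_col D)"
    using arg_cong[OF orthonormal_kernel_basis_mult_eq_0[OF K], of mat_adjoint] dim
    by (simp add: mat_adjoint_mult)
  have "?C * D = Dp * (pinv D * D) +
      mat_adjoint (pinv E) * mat_adjoint Ep * K * (mat_adjoint K * D)"
    using dims dim by (simp add: mat_distrib_dim assoc_mult_mat_dim)
  also have "\<dots> = Dp"
    using dims by (simp add: KD pinv_mult_self_full_column_rank[OF D] mat_unit_dim)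
      (intro eq_matI; simp)
  finally have CD: "?C * D = Dp" .
  have EE: "mat_adjoint E * mat_adjoint (pinv E) = 1\<^sub>m (dim_col E)"
    using arg_cong[OF pinv_mult_self_full_column_rank[OF E], of mat_adjoint]
    by (simp add: mat_adjoint_mult)
  have "mat_adjoint E * ?C = mat_adjoint E * Dp * pinv D +
      (mat_adjoint E * mat_adjoint (pinv E)) * (mat_adjoint Ep * (K * mat_adjoint K))"
    using dims dim by (simp add: mat_distrib_dim assoc_mult_mat_dim)
  also have "\<dots> = mat_adjoint Ep * (D * pinv D + K * mat_adjoint K)"
    using dims dim
    by (simp add: compatible EE mat_unit_dim mat_distrib_dim assoc_mult_mat_dim)
  also have "\<dots> = mat_adjoint Ep"
    using dims by (simp add: range_kernel_decomposition[OF D K] mat_unit_dim)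
  finally show ?thesis
    using CD dims dim by (auto simp: constraint_set_def intro: carrier_matI)
qed

text \<open>Any feasible C may serve as base point: the feasible matrices are exactly C + L N K^H,
  which turns the objective into an unconstrained least squares problem in N.\<close>

lemma constrained_least_squares:
  assumes C: "C \<in> constraint_set D Dp E Ep" and row: "dim_row D = dim_row E"
    and K: "orthonormal_kernel_basis (mat_adjoint D) K"
    and L: "orthonormal_kernel_basis (mat_adjoint E) L"
    and dims: "dim_row X = dim_row D" "dim_row Y = dim_row D" "dim_col Y = dim_col X"
  shows "is_arg_min (\<lambda>A. (frobenius_norm (A * X - Y))\<^sup>2) (\<lambda>A. A \<in> constraint_set D Dp E Ep)
    (C + L * (mat_adjoint L * (Y - C * X) * pinv (mat_adjoint K * X)) * mat_adjoint K)"
proof -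
  note dim = orthonormal_kernel_basis_dim[OF K, simplified] orthonormal_kernel_basis_dim[OF L, simplified]
  let ?W = "mat_adjoint K * X" and ?R = "Y - C * X"
  let ?Z = "mat_adjoint L * ?R * pinv ?W"
  have dimC: "dim_row C = dim_row D" "dim_col C = dim_row D"
    using C by (auto simp: constraint_set_def)
  have residual: "(C + L * N * mat_adjoint K) * X - Y = L * N * ?W - ?R"
    if "dim_row N = dim_col L" "dim_col N = dim_col K" for N
  proof -
    have "(C + L * N * mat_adjoint K) * X = C * X + L * N * ?W"
      using that dim dims dimC row by (simp add: mat_distrib_dim assoc_mult_mat_dim)
    thus ?thesis
      using that dim dims dimC row by (simp only:) (intro eq_matI; simp)
  qed
  show ?thesis
    unfolding is_arg_min_def
  proof (intro conjI notI)
    show "C + L * ?Z * mat_adjoint K \<in> constraint_set D Dp E Ep"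
      by (rule constraint_set_shift[OF C row K L]) simp_all
    assume "\<exists>A. A \<in> constraint_set D Dp E Ep \<and> (frobenius_norm (A * X - Y))\<^sup>2
      < (frobenius_norm ((C + L * ?Z * mat_adjoint K) * X - Y))\<^sup>2"
    then obtain A where A: "A \<in> constraint_set D Dp E Ep"
      and less: "(frobenius_norm (A * X - Y))\<^sup>2
        < (frobenius_norm ((C + L * ?Z * mat_adjoint K) * X - Y))\<^sup>2" by blast
    \<comment> \<open>The parameter of the supposedly better competitor \<open>A\<close>, to be
      compared with the least squares solution \<open>?Z\<close>.\<close>
    let ?N = "mat_adjoint L * (A - C) * K"
    have dimA: "dim_row A = dim_row D" "dim_col A = dim_row D"
      using A by (auto simp: constraint_set_def)
    have "C + L * ?N * mat_adjoint K = A"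
      unfolding constraint_set_difference[OF A C row K L]
      using dimA dimC by (intro eq_matI) simp_all
    with residual[of ?N] have "A * X - Y = L * ?N * ?W - ?R" by simp
    moreover have "(frobenius_norm (L * ?Z * ?W - ?R))\<^sup>2 \<le> (frobenius_norm (L * ?N * ?W - ?R))\<^sup>2"
      using dim dims dimA dimC row
      by (intro pinv_least_squares orthonormal_kernel_basis_mult_self[OF L]) simp_all
    ultimately show False
      using less residual[of ?Z] by simp
  qed
qed

theorem theorem6p1:
  fixes \<Gamma> :: "real ^ 'p::finite \<Rightarrow> real ^ 'p"
    and \<psi> :: "(real ^ 'p \<Rightarrow> complex) Matrix.vec"
    and m :: nat
    and samples geom :: "(real ^ 'p) list"
    and es eps :: "complex Matrix.vec list"
    and X Y D Dp E Ep Dperp Eperp C0 Alsq :: "complex mat"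
  assumes psi: "\<psi> \<in> carrier_vec m"
    and X: "X = data_matrix \<psi> samples"
    and Y: "Y = data_matrix \<psi> (map \<Gamma> samples)"
    and D: "D = data_matrix \<psi> geom"
    and Dp: "Dp = data_matrix \<psi> (map \<Gamma> geom)"
    and es_dim: "set es \<subseteq> carrier_vec m"
    and eps_dim: "set eps \<subseteq> carrier_vec m"
    and eps: "list_all2 (\<lambda>e ep. koopman \<Gamma> (dict_comb e \<psi>) = dict_comb ep \<psi>) es eps"
    and E: "E = mat_of_cols m es"
    and Ep: "Ep = mat_of_cols m eps"
    and compatible: "mat_adjoint E * Dp = mat_adjoint Ep * D"
    and D_rank: "full_column_rank D"
    and E_rank: "full_column_rank E"
    and Dperp: "orthonormal_kernel_basis (mat_adjoint D) Dperp"
    and Eperp: "orthonormal_kernel_basis (mat_adjoint E) Eperp"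
    and C0: "C0 = Dp * pinv D
       + mat_adjoint (pinv E) * mat_adjoint Ep * Dperp * mat_adjoint Dperp"
    and Alsq: "Alsq = mat_adjoint Eperp * (Y - C0 * X) * pinv (mat_adjoint Dperp * X)"
  shows "is_arg_min (\<lambda>A. (frobenius_norm (A * X - Y))\<^sup>2)
           (\<lambda>A. A \<in> constraint_set D Dp E Ep)
           (C0 + Eperp * Alsq * mat_adjoint Dperp)"
proof -
  have row: "dim_row X = m" "dim_row Y = m" "dim_row D = m" "dim_row Dp = m"
      "dim_row E = m" "dim_row Ep = m"
    and col: "dim_col Y = dim_col X" "dim_col Dp = dim_col D"
    using psi by (auto simp: X Y D Dp E Ep data_matrix_def)
  \<comment> \<open>\<open>list_all2\<close> pairs the vectors of \<open>es\<close> and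
    \<open>eps\<close>, so both lists have the same length.\<close>
  have "dim_col Ep = dim_col E"
    using list_all2_lengthD[OF eps] by (simp add: E Ep)
  hence "C0 \<in> constraint_set D Dp E Ep"
    unfolding C0 using row col
    by (intro particular_solution_in_constraint_set compatible D_rank E_rank Dperp) simp_all
  thus ?thesis
    unfolding Alsq using row col by (intro constrained_least_squares Dperp Eperp) simp_all
qed

end
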